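(* Let $p$ be an odd prime, let $n$ be a positive integer, and let $G=C_{p^n}^3$. Then $$\mathsf{s}_{\le \mathsf D(G)-p^n}(G)=\mathsf D(G)+p^n.$$
   Context: $C_m$ denotes the cyclic group of order $m$, written additively, and $C_m^r$ is the direct sum of $r$ copies of $C_m$. For a finite abelian group $G$ (written additively), a sequence over $G$ is a finite unordered list of elements of $G$ with repetition allowed (a finite multiset); its length is its number of terms counted with multiplicity, and it is zero-sum if the sum of its terms (with multiplicity) is $0$. A subsequence is a sub-multiset. The Davenport constant $\mathsf D(G)$ is the smallest integer $\ell$ such that every sequence over $G$ of length $\ell$ has a nonempty zero-sum subsequence. For an integer $t$ with $\exp(G)\le t\le \mathsf D(G)$, where $\exp(G)$ is the exponent of $G$, $\mathsf{s}_{\le t}(G)$ denotes the smallest integer $\ell$ such that every sequence over $G$ of length $\ell$ has a zero-sum subsequence $T$ of length $1\le |T|\le t$. *)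

theory Defs
  imports
    "HOL-Algebra.FiniteProduct"
    "HOL-Algebra.Elementary_Groups"
    "HOL-Algebra.Product_Groups"
    "HOL-Computational_Algebra.Primes"
    "HOL-Library.Multiset"
begin

(* Groups are HOL-Algebra commutative groups, whose operation is written multiplicatively;
   so the additive "sum" and "0" of the mathematics are the group product and the unit here. *)

definition cyclic_power :: "nat \<Rightarrow> nat \<Rightarrow> (nat \<Rightarrow> int) monoid" where
  "cyclic_power m r = product_group {..<r} (\<lambda>_. integer_mod_group m)"

definition sequence_over :: "('a, 'b) monoid_scheme \<Rightarrow> 'a multiset \<Rightarrow> bool" where
  "sequence_over G S \<longleftrightarrow> set_mset S \<subseteq> carrier G"

(* finprod ranges over a set of distinct elements, so each term g enters as its
   count-th power. *)
definition seq_sum :: "('a, 'b) monoid_scheme \<Rightarrow> 'a multiset \<Rightarrow> 'a" where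
  "seq_sum G S = finprod G (\<lambda>g. g [^]\<^bsub>G\<^esub> count S g) (set_mset S)"

definition zero_sum :: "('a, 'b) monoid_scheme \<Rightarrow> 'a multiset \<Rightarrow> bool" where
  "zero_sum G S \<longleftrightarrow> seq_sum G S = \<one>\<^bsub>G\<^esub>"

definition davenport :: "('a, 'b) monoid_scheme \<Rightarrow> nat" where
  "davenport G = (LEAST l. \<forall>S. sequence_over G S \<and> size S = l \<longrightarrow>
     (\<exists>T. T \<subseteq># S \<and> T \<noteq> {#} \<and> zero_sum G T))"

(* Meant for finite G and t at least the exponent of G; then such an l exists. *)
definition s_le :: "nat \<Rightarrow> ('a, 'b) monoid_scheme \<Rightarrow> nat" where
  "s_le t G = (LEAST l. \<forall>S. sequence_over G S \<and> size S = l \<longrightarrow>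
     (\<exists>T. T \<subseteq># S \<and> 1 \<le> size T \<and> size T \<le> t \<and> zero_sum G T))"

lemma comm_group_cyclic_power: "comm_group (cyclic_power m r)"
proof -
  have "group (product_group {..<r} (\<lambda>_. integer_mod_group m))"
    by (simp add: product_group)
  moreover have "\<And>x y. x \<otimes>\<^bsub>integer_mod_group m\<^esub> y = y \<otimes>\<^bsub>integer_mod_group m\<^esub> x"
    by (simp add: integer_mod_group_def add.commute integer_group_def)
  ultimately show ?thesis
    unfolding cyclic_power_def
    by (intro group.group_comm_groupI) (auto simp: product_group_def)
qed

lemma card_cyclic_power:
  assumes "m > 0"
  shows "card (carrier (cyclic_power m r)) = m ^ r"
  using assms
  by (simp add: cyclic_power_def carrier_integer_mod_group card_PiE)

lemma finite_cyclic_power: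
  assumes "m > 0"
  shows "finite (carrier (cyclic_power m r))"
  using assms
  by (simp add: cyclic_power_def carrier_integer_mod_group finite_PiE)

end

theory Submission
  imports Defs "HOL-Number_Theory.Cong"
begin

text \<open>Write \<open>q = p ^ n\<close>, so that \<open>D(G) = 3 * q - 2\<close>, and suppose that \<open>S\<close> of length \<open>4 * q - 2\<close> has no
  nonempty zero-sum subsequence of length at most \<open>2 * q - 2\<close>. A zero-sum \<open>T\<close> of length greater than \<open>D(G)\<close> splits into two
  zero-sums of length at least \<open>2 * q - 1\<close>, so \<open>T = S\<close>. Let \<open>c = q * (p - 2) + 1\<close>. Since
  \<open>(-1) ^ |T|\<close> is orthogonal to functions of \<open>T\<close> of degree less than \<open>|S|\<close>, the sum of
  \<open>(-1) ^ |T| * ((|T| + c) choose q)\<close> over all zero-sum \<open>T\<close> vanishes modulo \<open>p\<close>. The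
  binomial is \<open>p - 2\<close> for \<open>T\<close> empty, \<open>1\<close> for \<open>T = S\<close>, and \<open>0\<close> for \<open>2 * q - 1 \<le> |T| \<le> 3 * q - 2\<close>;
  hence \<open>p\<close> divides \<open>p - 2\<close> or \<open>p - 1\<close>, which is absurd for odd \<open>p\<close>.

  The lower bound is attained by \<open>q - 1\<close> copies each of the three basis vectors and of \<open>(1, 1, -1)\<close>,
  together with \<open>(2, 1, -1)\<close>.\<close>

section \<open>Polynomials in subset indicators and their alternating sums\<close>

text \<open>Functions of degree at most \<open>d\<close> in the \<open>0/1\<close> indicator variables of the elements of \<open>I\<close>.\<close>

inductive subset_poly :: "'a set \<Rightarrow> nat \<Rightarrow> ('a set \<Rightarrow> int) \<Rightarrow> bool" for I where
  indicator: "card U \<le> d \<Longrightarrow> U \<subseteq> I \<Longrightarrow> subset_poly I d (\<lambda>T. of_bool (U \<subseteq> T))"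
| add: "subset_poly I d F \<Longrightarrow> subset_poly I d H \<Longrightarrow> subset_poly I d (\<lambda>T. F T + H T)"
| scale: "subset_poly I d F \<Longrightarrow> subset_poly I d (\<lambda>T. c * F T)"

lemma subset_poly_const: "subset_poly I d (\<lambda>T. c)"
  using scale[OF indicator[of "{}" d I], of c] by simp

lemma subset_poly_sum:
  "(\<And>x. x \<in> A \<Longrightarrow> subset_poly I d (F x)) \<Longrightarrow> subset_poly I d (\<lambda>T. \<Sum>x\<in>A. F x T)"
  by (induction A rule: infinite_finite_induct) (auto intro: subset_poly_const add)

text \<open>The product of the indicators of \<open>U\<close> and \<open>V\<close> is the indicator
  of \<open>U \<union> V\<close>, whose cardinality is at most the sum of theirs; bilinearity does
  the rest.\<close>

lemma subset_poly_mult: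
  assumes "subset_poly I d F" "subset_poly I e H"
  shows "subset_poly I (d + e) (\<lambda>T. F T * H T)"
  using assms(1)
proof (induction rule: subset_poly.induct)
  case (indicator U d)
  note U = indicator
  show ?case using assms(2)
  proof (induction rule: subset_poly.induct)
    case (indicator V e)
    have "card (U \<union> V) \<le> d + e"
      using card_Un_le[of U V] U indicator by linarith
    then have "subset_poly I (d + e) (\<lambda>T. of_bool (U \<union> V \<subseteq> T))"
      using U indicator by (intro subset_poly.indicator) auto
    moreover have "of_bool (U \<union> V \<subseteq> T) = (of_bool (U \<subseteq> T) * of_bool (V \<subseteq> T) :: int)" for T
      by auto
    ultimately show ?case by simp
  next
    case (add e F H)
    then show ?case using subset_poly.add by (fastforce simp: distrib_left)
  next
    case (scale e F c)
    then show ?case using subset_poly.scale[of I "d + e" _ c] by (fastforce simp: mult.left_commute)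
  qed
next
  case (add d F F')
  then show ?case using subset_poly.add by (fastforce simp: distrib_right)
next
  case (scale d F c)
  then show ?case using subset_poly.scale[of I "d + e" _ c] by (fastforce simp: mult.assoc)
qed

lemma subset_poly_prod:
  "finite A \<Longrightarrow> (\<And>x. x \<in> A \<Longrightarrow> subset_poly I d (F x))
    \<Longrightarrow> subset_poly I (card A * d) (\<lambda>T. \<Prod>x\<in>A. F x T)"
  by (induction A rule: finite_induct) (auto intro: subset_poly_const subset_poly_mult)

text \<open>Vandermonde's identity peels off one element of \<open>J\<close> at a time.\<close>

lemma subset_poly_binomial:
  assumes "finite J" "J \<subseteq> I"
  shows "subset_poly I d (\<lambda>T. int ((sum a (T \<inter> J) + c) choose d))"
  using assms
proof (induction J arbitrary: d rule: finite_induct)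
  case empty
  then show ?case by (simp add: subset_poly_const)
next
  case (insert x J)
  \<comment> \<open>Term \<open>k\<close> of Vandermonde's sum when \<open>a x\<close> is split off.
    If \<open>x\<close> is absent from \<open>T\<close>, only \<open>k = 0\<close> contributes; for
    \<open>k > 0\<close> the indicator of \<open>{x}\<close> has degree 1, hence at most
    \<open>k\<close>.\<close>
  let ?F = "\<lambda>T k. (if k = 0 then 1 else int (a x choose k) * of_bool ({x} \<subseteq> T))
              * int ((sum a (T \<inter> J) + c) choose (d - k))"
  have "subset_poly I d (\<lambda>T. ?F T k)" if "k \<le> d" for k
  proof -
    have "subset_poly I k (\<lambda>T. if k = 0 then 1 else int (a x choose k) * of_bool ({x} \<subseteq> T))"
      using insert.prems
      by (cases "k = 0") (auto simp del: insert_subset intro!: subset_poly_const scale indicator)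
    then have "subset_poly I (k + (d - k)) (\<lambda>T. ?F T k)"
      by (rule subset_poly_mult) (use insert in auto)
    then show ?thesis using that by simp
  qed
  then have *: "subset_poly I d (\<lambda>T. \<Sum>k\<le>d. ?F T k)"
    by (intro subset_poly_sum) auto
  have "(\<Sum>k\<le>d. ?F T k) = int ((sum a (T \<inter> insert x J) + c) choose d)" for T
  proof (cases "x \<in> T")
    case True
    then have "sum a (T \<inter> insert x J) + c = a x + (sum a (T \<inter> J) + c)"
      using insert by simp
    then have "int ((sum a (T \<inter> insert x J) + c) choose d)
        = int (\<Sum>k\<le>d. (a x choose k) * ((sum a (T \<inter> J) + c) choose (d - k)))"
      by (simp only: vandermonde)
    also have "\<dots> = (\<Sum>k\<le>d. ?F T k)"
      using True by (auto intro!: sum.cong)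
    finally show ?thesis by simp
  next
    case False
    then have "?F T k = (if k = 0 then int ((sum a (T \<inter> J) + c) choose d) else 0)" for k
      by simp
    then have "(\<Sum>k\<le>d. ?F T k) = int ((sum a (T \<inter> J) + c) choose d)"
      by (simp only: sum.delta finite_atMost) simp
    then show ?thesis using False by simp
  qed
  with * show ?case by simp
qed

text \<open>By linearity it suffices to treat the indicator of one set \<open>U\<close>. Some
  \<open>x\<close> of \<open>I\<close> lies outside \<open>U\<close>, and adding or removing
  \<open>x\<close> pairs subsets of \<open>I\<close> whose terms cancel.\<close>

lemma alternating_sum_subset_poly:
  assumes "subset_poly I d F" "finite I" "d < card I"
  shows "(\<Sum>T\<in>Pow I. (-1) ^ card T * F T) = 0"
  using assms(1,3)
proof (induction rule: subset_poly.induct)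
  case (indicator U d)
  then obtain x where x: "x \<in> I" "x \<notin> U"
    by (metis card_mono finite_subset[OF _ assms(2)] not_less order.trans subsetI order_refl)
  define J where "J = I - {x}"
  have J: "I = insert x J" "x \<notin> J" "finite J"
    using x assms(2) by (auto simp: J_def)
  let ?f = "\<lambda>T. (-1) ^ card T * of_bool (U \<subseteq> T) :: int"
  have "sum ?f (Pow I) = sum ?f (Pow J) + sum ?f (insert x ` Pow J)"
    unfolding J(1) Pow_insert using J by (intro sum.union_disjoint) auto
  also have "sum ?f (insert x ` Pow J) = (\<Sum>T\<in>Pow J. ?f (insert x T))"
    using J(2) by (subst sum.reindex) (auto simp: inj_on_def)
  also have "\<dots> = (\<Sum>T\<in>Pow J. - ?f T)"
  proof (rule sum.cong)
    fix T assume "T \<in> Pow J"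
    then have "x \<notin> T" "finite T" using J finite_subset by auto
    then show "?f (insert x T) = - ?f T"
      using x by (auto simp: subset_insert)
  qed simp
  finally show ?case by (simp add: sum_negf)
next
  case (add d F H)
  then show ?case by (simp add: distrib_left sum.distrib)
next
  case (scale d F c)
  then show ?case by (simp add: mult.left_commute flip: sum_distrib_left)
qed

section \<open>Binomial coefficients modulo a prime\<close>

text \<open>The product \<open>(p ^ n choose k) * k\<close> is a multiple of \<open>p ^ n\<close>.
  Were the binomial prime to \<open>p\<close>, all of \<open>p ^ n\<close> would divide the smaller
  number \<open>k\<close>.\<close>

lemma prime_dvd_prime_power_choose:
  fixes p :: nat
  assumes "prime p" "0 < k" "k < p ^ n"
  shows "p dvd (p ^ n choose k)"
proof (rule ccontr)
  assume "\<not> p dvd (p ^ n choose k)"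
  moreover have "p ^ n dvd (p ^ n choose k) * k"
    using times_binomial_minus1_eq[of k "p ^ n"] assms(2) by (metis dvd_triv_left mult.commute)
  moreover have "n > 0" using assms by (cases n) auto
  ultimately have "p ^ n dvd k"
    using prime_power_dvd_multD[OF prime_imp_prime_elem[OF assms(1)]] by blast
  then show False using assms by (auto dest: dvd_imp_le)
qed

text \<open>Coefficient form of \<open>(1 + X)^q = 1 + X^q\<close> modulo \<open>p\<close>: in
  Vandermonde's sum only \<open>i = 0\<close> and \<open>i = q\<close> survive, the latter being in
  range only for \<open>k = q\<close>.\<close>

lemma cong_prime_power_add_choose:
  fixes p :: nat
  assumes "prime p" "q = p ^ n" "k \<le> q"
  shows "[(q + m) choose k = (m choose k) + of_bool (k = q)] (mod p)"
proof -
  have q: "q > 0" using assms prime_gt_0_nat by auto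
  have "[(\<Sum>i\<le>k. (q choose i) * (m choose (k - i)))
      = (\<Sum>i\<le>k. (if i = 0 then m choose k else 0) + (if i = q then of_bool (k = q) else 0))] (mod p)"
  proof (rule cong_sum)
    fix i assume "i \<in> {..k}"
    then consider "i = 0" | "i = q" "k = q" | "0 < i" "i < q"
      using assms(3) by fastforce
    then show "[(q choose i) * (m choose (k - i))
        = (if i = 0 then m choose k else 0) + (if i = q then of_bool (k = q) else 0)] (mod p)"
    proof cases
      case 3
      then show ?thesis
        using prime_dvd_prime_power_choose[OF assms(1), of i n] assms(2)
        by (auto simp: cong_0_iff)
    qed (use q in auto)
  qed
  also have "(\<Sum>i\<le>k. (if i = 0 then m choose k else 0) + (if i = q then of_bool (k = q) else 0))
      = (m choose k) + of_bool (k = q)"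
    by (simp add: sum.distrib)
  finally show ?thesis by (simp only: vandermonde)
qed

text \<open>A case of Lucas's congruence: each further \<open>q\<close> in the upper argument leaves
  the residue unchanged.\<close>

lemma cong_choose_less_prime_power:
  fixes p :: nat
  assumes "prime p" "q = p ^ n" "k < q"
  shows "[(q * s + m) choose k = m choose k] (mod p)"
proof (induction s)
  case (Suc s)
  have "[(q + (q * s + m)) choose k = (q * s + m) choose k] (mod p)"
    using cong_prime_power_add_choose[OF assms(1,2), of k] assms(3) by simp
  with Suc show ?case by (auto simp: add.assoc intro: cong_trans)
qed simp

text \<open>Each further \<open>q\<close> raises the residue by 1, starting from
  \<open>m choose q = 0\<close>; the coefficient thus reads off the quotient by
  \<open>q\<close>.\<close>

lemma cong_choose_prime_power:
  fixes p :: nat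
  assumes "prime p" "q = p ^ n" "m < q"
  shows "[(q * s + m) choose q = s] (mod p)"
proof (induction s)
  case 0
  then show ?case using assms(3) by (simp add: binomial_eq_0)
next
  case (Suc s)
  have "[(q + (q * s + m)) choose q = ((q * s + m) choose q) + 1] (mod p)"
    using cong_prime_power_add_choose[OF assms(1,2), of q] by simp
  also have "[((q * s + m) choose q) + 1 = s + 1] (mod p)"
    using Suc by (intro cong_add) auto
  finally show ?case by (simp add: add.assoc)
qed

text \<open>If \<open>q\<close> divides \<open>x\<close>, the residue is that of
  \<open>(q - 1) choose (q - 1)\<close>. Otherwise adding \<open>q - 1\<close> carries into the next
  multiple of \<open>q\<close> and leaves \<open>(m - 1) choose (q - 1) = 0\<close>, where
  \<open>m\<close> is the remainder of \<open>x\<close>.\<close>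

lemma cong_dvd_indicator_choose:
  fixes p :: nat
  assumes "prime p" "q = p ^ n"
  shows "[(x + (q - 1)) choose (q - 1) = of_bool (q dvd x)] (mod p)"
proof -
  have q: "q > 0" using assms prime_gt_0_nat by auto
  define m s where "m = x mod q" and "s = x div q"
  have x: "x = q * s + m" and m: "m < q" using q by (simp_all add: m_def s_def)
  show ?thesis
  proof (cases "m = 0")
    case True
    then show ?thesis
      using cong_choose_less_prime_power[OF assms, of "q - 1" s "q - 1"] q x by simp
  next
    case False
    then have "x + (q - 1) = q * Suc s + (m - 1)" using x q by simp
    moreover have "\<not> q dvd x" using False by (simp add: m_def dvd_eq_mod_eq_0)
    moreover have "(m - 1) choose (q - 1) = 0" using m False by simp
    moreover have "[(q * Suc s + (m - 1)) choose (q - 1) = (m - 1) choose (q - 1)] (mod p)"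
      using q by (intro cong_choose_less_prime_power[OF assms]) simp
    ultimately show ?thesis by (simp only: of_bool_eq)
  qed
qed

section \<open>Zero-sum subsets of an index set\<close>

text \<open>Modulo \<open>p\<close>, divisibility by \<open>q\<close> of a subset sum is a polynomial condition of degree \<open>q - 1\<close>,
  so that the summand below has degree at most \<open>card K * (q - 1) + d\<close>.\<close>

lemma alternating_zero_sum_cong:
  fixes p :: nat and a :: "'k \<Rightarrow> 'i \<Rightarrow> nat"
  assumes "prime p" "q = p ^ n" "finite K" "finite I" "card K * (q - 1) + d < card I"
  shows "[(\<Sum>T\<in>Pow I. (-1) ^ card T * (int ((card T + c) choose d)
      * of_bool (\<forall>k\<in>K. q dvd sum (a k) T))) = 0] (mod int p)"
proof -
  define H where "H T = (\<Prod>k\<in>K. int ((sum (a k) (T \<inter> I) + (q - 1)) choose (q - 1)))" for T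
  define F where "F T = int ((card (T \<inter> I) + c) choose d)" for T
  have "subset_poly I d F"
    unfolding F_def using subset_poly_binomial[OF assms(4) order_refl, of d "\<lambda>_. 1" c] by simp
  moreover have "subset_poly I (card K * (q - 1)) H"
    unfolding H_def by (intro subset_poly_prod subset_poly_binomial assms order_refl)
  ultimately have "subset_poly I (d + card K * (q - 1)) (\<lambda>T. F T * H T)"
    by (rule subset_poly_mult)
  then have "(\<Sum>T\<in>Pow I. (-1) ^ card T * (F T * H T)) = 0"
    by (rule alternating_sum_subset_poly[OF _ assms(4)]) (use assms(5) in simp)
  moreover have "[(\<Sum>T\<in>Pow I. (-1) ^ card T * (int ((card T + c) choose d)
      * of_bool (\<forall>k\<in>K. q dvd sum (a k) T))) = (\<Sum>T\<in>Pow I. (-1) ^ card T * (F T * H T))] (mod int p)"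
  proof (rule cong_sum)
    fix T assume "T \<in> Pow I"
    then have T: "T \<inter> I = T" by auto
    have "[H T = (\<Prod>k\<in>K. int (of_bool (q dvd sum (a k) T)))] (mod int p)"
      unfolding H_def T
      by (intro cong_prod) (simp only: cong_int_iff cong_dvd_indicator_choose[OF assms(1,2)])
    also have "(\<Prod>k\<in>K. int (of_bool (q dvd sum (a k) T))) = of_bool (\<forall>k\<in>K. q dvd sum (a k) T)"
      using assms(3) by (induction K rule: finite_induct) auto
    finally show "[(-1) ^ card T * (int ((card T + c) choose d) * of_bool (\<forall>k\<in>K. q dvd sum (a k) T))
        = (-1) ^ card T * (F T * H T)] (mod int p)"
      unfolding F_def T by (intro cong_mult cong_refl) (rule cong_sym)
  qed
  ultimately show ?thesis by simp
qed

text \<open>For \<open>d = 0\<close> the preceding congruence counts zero-sum subsets with sign, and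
  the empty set alone would give 1. This is Olson's upper bound for the Davenport constant of a
  power of \<open>C_q\<close>.\<close>

lemma nonempty_zero_sum_subset:
  fixes p :: nat and a :: "'k \<Rightarrow> 'i \<Rightarrow> nat"
  assumes "prime p" "q = p ^ n" "finite K" "finite I" "card K * (q - 1) < card I"
  shows "\<exists>T\<subseteq>I. T \<noteq> {} \<and> (\<forall>k\<in>K. q dvd sum (a k) T)"
proof (rule ccontr)
  assume *: "\<not> ?thesis"
  have "(\<Sum>T\<in>Pow I. (-1) ^ card T * (int ((card T + 0) choose 0)
      * of_bool (\<forall>k\<in>K. q dvd sum (a k) T))) = (\<Sum>T\<in>Pow I. if T = {} then 1 else (0::int))"
    using * by (intro sum.cong) auto
  also have "\<dots> = 1" using assms by simp
  finally have "[1 = 0] (mod int p)"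
    using alternating_zero_sum_cong[OF assms(1-4), of 0 0 a] assms(5) by simp
  then show False using prime_gt_1_nat[OF assms(1)] by (simp add: cong_0_iff)
qed

text \<open>The upper bound, stated for indices so that equal terms stay distinguishable;
  \<open>a k j\<close> is coordinate \<open>k\<close> of term \<open>j\<close>.\<close>

lemma short_zero_sum_subset:
  fixes p :: nat and a :: "'k \<Rightarrow> 'i \<Rightarrow> nat"
  assumes p: "prime p" "odd p" and q: "q = p ^ n" "n > 0"
    and K: "finite K" "card K = 3" and I: "finite I" "card I = 4 * q - 2"
  shows "\<exists>T\<subseteq>I. T \<noteq> {} \<and> card T \<le> 2 * q - 2 \<and> (\<forall>k\<in>K. q dvd sum (a k) T)"
proof (rule ccontr)
  assume no_short: "\<not> ?thesis"
  define Z where "Z T \<longleftrightarrow> (\<forall>k\<in>K. q dvd sum (a k) T)" for T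
  have p3: "p \<ge> 3"
    using p prime_ge_2_nat[of p] by (cases "p = 2") auto
  have q3: "q \<ge> 3"
    using p3 q self_le_power[of p n] by simp
  have long: "2 * q - 1 \<le> card T" if "T \<subseteq> I" "T \<noteq> {}" "Z T" for T
  proof (rule ccontr)
    assume "\<not> 2 * q - 1 \<le> card T"
    then have "card T \<le> 2 * q - 2" by simp
    then show False using no_short that unfolding Z_def by blast
  qed
  have medium: "card T < 3 * q - 1" if T: "T \<subseteq> I" "T \<noteq> I" "Z T" for T
  proof (rule ccontr)
    assume "\<not> card T < 3 * q - 1"
    then have large: "3 * q - 1 \<le> card T" by simp
    have "T \<noteq> {}" using large q3 by auto
    \<comment> \<open>Setting \<open>x\<close> aside keeps \<open>T - U\<close> nonempty, and the at
      least \<open>3 * q - 2\<close> elements left still exceed \<open>3 * (q - 1)\<close>.\<close>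
    then obtain x where x: "x \<in> T" by auto
    have fin: "finite T" using T I finite_subset by auto
    have "card K * (q - 1) < card (T - {x})"
      using large x fin q3 K by (simp add: card_Diff_singleton)
    from nonempty_zero_sum_subset[OF p(1) q(1) K(1) _ this, of a]
    obtain U where U: "U \<subseteq> T - {x}" "U \<noteq> {}" "Z U"
      using fin by (auto simp: Z_def)
    have "U \<subseteq> T" "finite U" using U fin finite_subset by auto
    have "Z (T - U)"
      unfolding Z_def
    proof
      fix k assume k: "k \<in> K"
      have "sum (a k) T = sum (a k) (T - U) + sum (a k) U"
        using \<open>U \<subseteq> T\<close> fin by (rule sum.subset_diff)
      then show "q dvd sum (a k) (T - U)"
        using k T(3) U(3) unfolding Z_def by (metis dvd_add_left_iff)
    qed
    then have "2 * q - 1 \<le> card (T - U)"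
      using U T x by (intro long) auto
    moreover have "2 * q - 1 \<le> card U"
      using U T by (intro long) auto
    moreover have "card T = card (T - U) + card U"
      using \<open>U \<subseteq> T\<close> \<open>finite U\<close> fin by (simp add: card_Diff_subset card_mono)
    \<comment> \<open>The two pieces together have at least \<open>4 * q - 2 = card I\<close>
      elements, which forces \<open>T = I\<close>.\<close>
    ultimately have "card I \<le> card T" using I q3 by simp
    then show False using T I by (metis card_seteq)
  qed
  \<comment> \<open>The shift moves the range from \<open>2 * q - 1\<close> to
    \<open>3 * q - 2\<close> exactly onto the block from \<open>q * p\<close> to
    \<open>q * p + (q - 1)\<close>, where the binomial is \<open>p\<close>, hence 0, modulo
    \<open>p\<close>. The sizes 0 and \<open>4 * q - 2\<close> land in the blocks of quotient
    \<open>p - 2\<close> and \<open>p + 1\<close>.\<close>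
  define c where "c = q * (p - 2) + 1"
  define t where "t T = (-1) ^ card T * (int ((card T + c) choose q) * of_bool (Z T))" for T
  have "[sum t (Pow I) = (\<Sum>T\<in>Pow I. (if T = {} then int (p - 2) else 0)
      + (if T = I then of_bool (Z I) else 0))] (mod int p)"
  proof (rule cong_sum)
    fix T assume "T \<in> Pow I"
    then consider "T = {}" | "T = I" "T \<noteq> {}" | "T \<noteq> {}" "T \<noteq> I" "\<not> Z T"
      | "T \<noteq> {}" "T \<noteq> I" "Z T" "T \<subseteq> I" by auto
    then show "[t T = (if T = {} then int (p - 2) else 0)
      + (if T = I then of_bool (Z I) else 0)] (mod int p)"
    proof cases
      case 1
      have "I \<noteq> {}" using I q3 by auto
      moreover have "[c choose q = p - 2] (mod p)"
        unfolding c_def using q3 by (intro cong_choose_prime_power[OF p(1) q(1)]) simp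
      ultimately show ?thesis
        using 1 by (auto simp: t_def Z_def cong_int_iff)
    next
      case 2
      have "card I + c = q * (p + 1) + (q - 1)"
        using p3 q3 I by (simp add: c_def algebra_simps diff_mult_distrib2)
      then have "[(card I + c) choose q = p + 1] (mod p)"
        using q3 cong_choose_prime_power[OF p(1) q(1), of "q - 1" "p + 1"] by simp
      also have "[p + 1 = 1] (mod p)" by (simp only: cong_def mod_add_self1)
      finally have "[int ((card I + c) choose q) = 1] (mod int p)"
        by (metis cong_int_iff of_nat_1)
      \<comment> \<open>The sign of the full set matters: a minus would allow the total
        \<open>p - 3\<close>, which vanishes for \<open>p = 3\<close>.\<close>
      moreover have "even (card I)" using I q3 by simp
      ultimately show ?thesis
        using 2 by (auto simp: t_def)
    next
      case 3
      then show ?thesis by (simp add: t_def)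
    next
      case 4
      have bounds: "2 * q - 1 \<le> card T" "card T < 3 * q - 1"
        using long medium 4 by auto
      define m where "m = card T - (2 * q - 1)"
      have "p - 2 + 2 = p" using p3 by simp
      then have "q * p = q * (p - 2) + q * 2" by (metis distrib_left)
      then have "card T + c = q * p + m"
        using bounds unfolding c_def m_def by linarith
      moreover have "m < q" using bounds q3 by (simp add: m_def)
      ultimately have "[(card T + c) choose q = p] (mod p)"
        using cong_choose_prime_power[OF p(1) q(1), of m p] by simp
      then have "p dvd ((card T + c) choose q)" by (simp add: cong_def dvd_eq_mod_eq_0)
      then show ?thesis
        using 4 by (simp add: t_def cong_0_iff)
    qed
  qed
  also have "(\<Sum>T\<in>Pow I. (if T = {} then int (p - 2) else 0) + (if T = I then of_bool (Z I) else 0))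
      = int (p - 2) + of_bool (Z I)"
    using I by (simp add: sum.distrib)
  finally have "[int (p - 2) + of_bool (Z I) = sum t (Pow I)] (mod int p)"
    by (rule cong_sym)
  \<comment> \<open>The degree is \<open>3 * (q - 1) + q = 4 * q - 3\<close>, one below
    \<open>card I\<close>.\<close>
  also have "[sum t (Pow I) = 0] (mod int p)"
    unfolding t_def Z_def using I K q3
    by (intro alternating_zero_sum_cong[OF p(1) q(1)]) auto
  finally have "int p dvd int (p - 2) + of_bool (Z I)"
    by (simp add: cong_0_iff)
  then have "int p \<le> int (p - 2) + of_bool (Z I)"
    using p3 by (intro zdvd_imp_le) (auto simp: add_pos_nonneg)
  then show False using p3 by (auto split: if_splits simp: of_bool_def)
qed

section \<open>From index sets to sequences over the group\<close>

lemma finprod_cyclic_power: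
  assumes "q > 0" "finite A" "f \<in> A \<rightarrow> carrier (cyclic_power q r)" "i < r"
  shows "finprod (cyclic_power q r) f A i = (\<Sum>x\<in>A. f x i) mod int q"
proof -
  interpret comm_group "cyclic_power q r" by (rule comm_group_cyclic_power)
  show ?thesis using assms(2,3)
  proof (induction A rule: finite_induct)
    case empty
    show ?case unfolding finprod_empty using assms(4) by (simp add: cyclic_power_def)
  next
    case (insert x A)
    then have "finprod (cyclic_power q r) f (insert x A) i
        = (f x \<otimes>\<^bsub>cyclic_power q r\<^esub> finprod (cyclic_power q r) f A) i"
      by (subst finprod_insert) auto
    also have "\<dots> = (f x i + finprod (cyclic_power q r) f A i) mod int q"
      using assms by (simp add: cyclic_power_def mult_integer_mod_group)
    finally show ?case using insert by (simp add: mod_simps)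
  qed
qed

lemma pow_cyclic_power:
  assumes "q > 0" "i < r" "x \<in> carrier (cyclic_power q r)"
  shows "(x [^]\<^bsub>cyclic_power q r\<^esub> (k::nat)) i = (int k * x i) mod int q"
proof -
  interpret comm_group "cyclic_power q r" by (rule comm_group_cyclic_power)
  show ?thesis
  proof (induction k)
    case 0
    then show ?case using assms by (simp add: cyclic_power_def)
  next
    case (Suc k)
    have "(x [^]\<^bsub>cyclic_power q r\<^esub> Suc k) i
        = ((x [^]\<^bsub>cyclic_power q r\<^esub> k) i + x i) mod int q"
      using assms by (simp add: cyclic_power_def mult_integer_mod_group)
    then show ?case using Suc by (simp add: mod_simps algebra_simps)
  qed
qed

lemma zero_sum_cyclic_power_iff:
  assumes "q > 0" "sequence_over (cyclic_power q r) S"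
  shows "zero_sum (cyclic_power q r) S
    \<longleftrightarrow> (\<forall>i<r. int q dvd (\<Sum>x\<in>set_mset S. int (count S x) * x i))"
proof -
  let ?G = "cyclic_power q r"
  interpret comm_group ?G by (rule comm_group_cyclic_power)
  have S: "set_mset S \<subseteq> carrier ?G" using assms by (simp add: sequence_over_def)
  have closed: "(\<lambda>g. g [^]\<^bsub>?G\<^esub> count S g) \<in> set_mset S \<rightarrow> carrier ?G"
    using S by auto
  have "seq_sum ?G S i = (\<Sum>x\<in>set_mset S. int (count S x) * x i) mod int q" if "i < r" for i
  proof -
    have "seq_sum ?G S i = (\<Sum>x\<in>set_mset S. (x [^]\<^bsub>?G\<^esub> count S x) i) mod int q"
      unfolding seq_sum_def by (rule finprod_cyclic_power[OF assms(1) _ closed that]) simp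
    also have "\<dots> = (\<Sum>x\<in>set_mset S. (int (count S x) * x i) mod int q) mod int q"
      using S pow_cyclic_power[OF assms(1) that] by (auto intro!: arg_cong2[of _ _ _ _ "(mod)"] sum.cong)
    finally show ?thesis by (simp add: mod_sum_eq)
  qed
  moreover have "seq_sum ?G S \<in> carrier ?G"
    unfolding seq_sum_def using closed by (rule finprod_closed)
  \<comment> \<open>Elements of the carrier are extensional functions, so the coordinates below
    \<open>r\<close> determine them.\<close>
  moreover have "x = \<one>\<^bsub>?G\<^esub> \<longleftrightarrow> (\<forall>i<r. x i = 0)" if "x \<in> carrier ?G" for x
  proof
    assume "\<forall>i<r. x i = 0"
    then show "x = \<one>\<^bsub>?G\<^esub>"
      using that by (auto simp: cyclic_power_def PiE_iff extensional_def)
  qed (simp add: cyclic_power_def)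
  ultimately show ?thesis
    by (simp add: zero_sum_def dvd_eq_mod_eq_0)
qed

lemma sum_mset_eq_sum_count:
  fixes f :: "'a \<Rightarrow> 'b :: comm_semiring_1"
  assumes "finite A" "set_mset M \<subseteq> A"
  shows "(\<Sum>x\<in>#M. f x) = (\<Sum>x\<in>A. of_nat (count M x) * f x)"
  using assms(2)
proof (induction M)
  case (add y M)
  have "(\<Sum>x\<in>A. of_nat (count (add_mset y M) x) * f x)
      = (\<Sum>x\<in>A. (if x = y then f y else 0) + of_nat (count M x) * f x)"
    by (intro sum.cong) (auto simp: distrib_right)
  also have "\<dots> = f y + (\<Sum>x\<in>A. of_nat (count M x) * f x)"
    using add.prems assms(1) by (simp add: sum.distrib)
  finally show ?case using add by simp
qed simp

text \<open>Listing \<open>S\<close> turns sets of positions into submultisets of the same size. The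
  assumption ranges over all arrays \<open>a\<close>, so it applies to the coordinates of the listed
  terms.\<close>

lemma ex_zero_sum_submultiset:
  assumes "q > 0" "sequence_over (cyclic_power q r) S"
    and ex: "\<And>a :: nat \<Rightarrow> nat \<Rightarrow> nat. \<exists>T\<subseteq>{..<size S}. P (card T) \<and> (\<forall>i\<in>{..<r}. q dvd sum (a i) T)"
  shows "\<exists>T. T \<subseteq># S \<and> P (size T) \<and> zero_sum (cyclic_power q r) T"
proof -
  obtain xs where xs: "mset xs = S" using ex_mset by blast
  define a where "a i j = nat ((xs ! j) i)" for i j
  obtain T where T: "T \<subseteq> {..<length xs}" "P (card T)" "\<And>i. i < r \<Longrightarrow> q dvd sum (a i) T"
    using ex[of a] xs by (auto simp flip: size_mset)
  define M where "M = image_mset ((!) xs) (mset_set T)"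
  have fin: "finite T" using T finite_subset by blast
  have "M \<subseteq># image_mset ((!) xs) (mset_set {..<length xs})"
    unfolding M_def using T by (intro image_mset_subseteq_mono subset_imp_msubset_mset_set) auto
  also have "\<dots> = S"
    using xs by (metis map_nth mset_map mset_upt atLeast0LessThan)
  finally have M: "M \<subseteq># S" .
  then have over: "sequence_over (cyclic_power q r) M"
    using assms(2) set_mset_mono by (fastforce simp: sequence_over_def)
  have "int q dvd (\<Sum>x\<in>set_mset M. int (count M x) * x i)" if i: "i < r" for i
  proof -
    \<comment> \<open>Coordinates are residues in \<open>{0..<q}\<close>, so \<open>nat\<close> in
      the definition of \<open>a\<close> loses nothing.\<close>
    have nonneg: "(xs ! j) i \<ge> 0" if "j \<in> T" for j
    proof -
      have "xs ! j \<in># S"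
        using that T(1) by (auto simp flip: xs)
      then have "xs ! j \<in> carrier (cyclic_power q r)"
        using assms(2) by (auto simp: sequence_over_def)
      then show ?thesis
        using i assms(1) by (auto simp: cyclic_power_def carrier_integer_mod_group PiE_iff)
    qed
    have "(\<Sum>x\<in>set_mset M. int (count M x) * x i) = (\<Sum>x\<in>#M. x i)"
      by (rule sum_mset_eq_sum_count[symmetric]) auto
    also have "\<dots> = (\<Sum>j\<in>T. (xs ! j) i)"
      by (simp add: M_def sum_unfold_sum_mset image_mset.compositionality o_def)
    also have "\<dots> = int (sum (a i) T)"
      using nonneg by (simp add: a_def)
    finally show ?thesis using T(3)[OF i] by (simp only: int_dvd_int_iff)
  qed
  then have "zero_sum (cyclic_power q r) M"
    using zero_sum_cyclic_power_iff[OF assms(1) over] by simp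
  moreover have "size M = card T" by (simp add: M_def)
  ultimately show ?thesis using M T by auto
qed

text \<open>Prefixes of a sequence avoiding \<open>Q\<close> avoid it too, so one such sequence of
  length \<open>l\<close> excludes every smaller length. Both constants have this shape.\<close>

lemma Least_forcing_length_eq:
  assumes "\<And>S. sequence_over G S \<Longrightarrow> size S = Suc l \<Longrightarrow> \<exists>T. T \<subseteq># S \<and> Q T"
    and "sequence_over G S" "size S = l" "\<And>T. T \<subseteq># S \<Longrightarrow> \<not> Q T"
  shows "(LEAST l. \<forall>S. sequence_over G S \<and> size S = l \<longrightarrow> (\<exists>T. T \<subseteq># S \<and> Q T)) = Suc l"
proof (rule Least_equality)
  fix k assume k: "\<forall>S. sequence_over G S \<and> size S = k \<longrightarrow> (\<exists>T. T \<subseteq># S \<and> Q T)"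
  show "Suc l \<le> k"
  proof (rule ccontr)
    assume "\<not> Suc l \<le> k"
    obtain xs where xs: "mset xs = S" using ex_mset by blast
    define R where "R = mset (take k xs)"
    have "R \<subseteq># S"
      unfolding R_def xs[symmetric] by (metis append_take_drop_id mset_append mset_subset_eq_add_left)
    moreover have "size R = k"
      using \<open>\<not> Suc l \<le> k\<close> xs assms(3) by (auto simp: R_def)
    moreover have "sequence_over G R"
      using \<open>R \<subseteq># S\<close> assms(2) set_mset_mono by (fastforce simp: sequence_over_def)
    ultimately obtain T where "T \<subseteq># R" "Q T" using k by blast
    then show False using assms(4) \<open>R \<subseteq># S\<close> subset_mset.order_trans by blast
  qed
qed (use assms in auto)

section \<open>Extremal sequences for the lower bounds\<close>

text \<open>The restriction to \<open>{..<3}\<close> makes the vector extensional, as membership in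
  the product group demands.\<close>

definition vec3 :: "int \<Rightarrow> int \<Rightarrow> int \<Rightarrow> nat \<Rightarrow> int" where
  "vec3 x y z = (\<lambda>i\<in>{..<3}. if i = 0 then x else if i = 1 then y else z)"

lemma vec3_simps [simp]:
  "vec3 x y z 0 = x" "vec3 x y z (Suc 0) = y" "vec3 x y z 2 = z"
  by (simp_all add: vec3_def)

lemma vec3_eq_iff: "vec3 x y z = vec3 x' y' z' \<longleftrightarrow> x = x' \<and> y = y' \<and> z = z'"
  by (metis vec3_simps)

definition basis_seq :: "nat \<Rightarrow> (nat \<Rightarrow> int) multiset" where
  "basis_seq q = replicate_mset (q - 1) (vec3 1 0 0) + replicate_mset (q - 1) (vec3 0 1 0)
     + replicate_mset (q - 1) (vec3 0 0 1)"

text \<open>The residue \<open>int q - 1\<close> represents -1. Keeping \<open>basis_seq\<close> as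
  a part lets one analysis of zero-sums serve both lower bounds.\<close>

definition extremal_seq :: "nat \<Rightarrow> (nat \<Rightarrow> int) multiset" where
  "extremal_seq q = basis_seq q + replicate_mset (q - 1) (vec3 1 1 (int q - 1))
     + {#vec3 2 1 (int q - 1)#}"

lemma size_basis_seq: "size (basis_seq q) = 3 * (q - 1)"
  by (simp add: basis_seq_def)

lemma size_extremal_seq: "size (extremal_seq q) = 4 * (q - 1) + 1"
  by (simp add: extremal_seq_def size_basis_seq)

text \<open>The bound \<open>q \<ge> 3\<close> makes the coordinate 2 a reduced residue.\<close>

lemma sequence_over_extremal_seq:
  assumes "q \<ge> 3"
  shows "sequence_over (cyclic_power q 3) (extremal_seq q)"
proof -
  have "vec3 x y z \<in> carrier (cyclic_power q 3)" if "{x, y, z} \<subseteq> {0..<int q}" for x y z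
    using that assms by (auto simp: vec3_def cyclic_power_def carrier_integer_mod_group)
  then show ?thesis
    using assms by (auto simp: sequence_over_def extremal_seq_def basis_seq_def)
qed

text \<open>The variables are the multiplicities of the five vectors in a zero-sum. With
  \<open>s = g + h\<close>, the first two coordinates give \<open>u + s + h \<ge> q\<close> and
  \<open>v + s \<ge> q\<close>, and the third gives \<open>w\<close> congruent to \<open>s\<close>.
  If \<open>s < q\<close>, then \<open>w = s\<close> and the total is at least
  \<open>2 * q - h\<close>.\<close>

lemma zero_sum_coefficients:
  fixes u v w g h q :: nat
  assumes "u < q" "v < q" "w < q" "g < q" "h \<le> 1" "g + h > 0"
    and "int q dvd int u + int g + 2 * int h" "int q dvd int v + int g + int h"
    and "int q dvd int w + (int q - 1) * int g + (int q - 1) * int h"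
  shows "2 * q - 1 \<le> u + v + w + g + h"
proof -
  have "int q dvd int w - int (g + h)"
  proof -
    have "int w - int (g + h) = int w + (int q - 1) * int g + (int q - 1) * int h - int q * int (g + h)"
      by (simp add: algebra_simps)
    then show ?thesis using assms(9) by (metis dvd_diff dvd_triv_left)
  qed
  have u: "q \<le> u + g + 2 * h"
    using zdvd_imp_le[OF assms(7)] assms(6) by linarith
  have v: "q \<le> v + g + h"
    using zdvd_imp_le[OF assms(8)] assms(6) by linarith
  show ?thesis
  proof (cases "g + h < q")
    case True
    have "int w - int (g + h) = 0"
    proof (rule ccontr)
      assume "int w - int (g + h) \<noteq> 0"
      from dvd_imp_le_int[OF this \<open>int q dvd int w - int (g + h)\<close>] show False
        using True assms(3) by linarith
    qed
    then show ?thesis using u v assms(5) by linarith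
  next
    case False
    \<comment> \<open>Here \<open>g = q - 1\<close> and \<open>h = 1\<close>, so the first
      coordinate forces \<open>u \<ge> q - 1\<close>, and \<open>u + g + h\<close> alone
      suffices.\<close>
    then have "g + h = q" "h = 1" using assms by linarith+
    then have "int u + int g + 2 * int h = int q + int (u + 1)" by simp
    then have "int q dvd int (u + 1)"
      using assms(7) by (metis dvd_add_right_iff dvd_refl)
    then have "q \<le> u + 1" by (intro dvd_imp_le) (simp_all only: int_dvd_int_iff)
    then show ?thesis using \<open>g + h = q\<close> by linarith
  qed
qed

text \<open>A zero-sum made of basis vectors alone has multiplicities below \<open>q\<close> and
  divisible by \<open>q\<close>, so it is empty; hence \<open>g + h > 0\<close>, which gives both
  claims.\<close>

lemma extremal_seq_zero_sum:
  assumes "q \<ge> 3" "T \<subseteq># extremal_seq q" "T \<noteq> {#}" "zero_sum (cyclic_power q 3) T"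
  shows "2 * q - 1 \<le> size T" "\<not> T \<subseteq># basis_seq q"
proof -
  define u v w g h where "u = count T (vec3 1 0 0)" and "v = count T (vec3 0 1 0)"
    and "w = count T (vec3 0 0 1)" and "g = count T (vec3 1 1 (int q - 1))"
    and "h = count T (vec3 2 1 (int q - 1))"
  note uvwgh = this
  define E where "E = {vec3 1 0 0, vec3 0 1 0, vec3 0 0 1, vec3 1 1 (int q - 1), vec3 2 1 (int q - 1)}"
  have le: "count T x \<le> count (extremal_seq q) x" for x
    using assms(2) by (rule mset_subset_eq_count)
  have bounds: "u \<le> q - 1" "v \<le> q - 1" "w \<le> q - 1" "g \<le> q - 1" "h \<le> 1"
    using le[of "vec3 1 0 0"] le[of "vec3 0 1 0"] le[of "vec3 0 0 1"]
      le[of "vec3 1 1 (int q - 1)"] le[of "vec3 2 1 (int q - 1)"] assms(1)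
    by (simp_all add: uvwgh extremal_seq_def basis_seq_def vec3_eq_iff)
  have "set_mset T \<subseteq> E"
    using set_mset_mono[OF assms(2)] by (auto simp: E_def extremal_seq_def basis_seq_def split: if_splits)
  \<comment> \<open>With \<open>f\<close> left free, the constant 1 yields the size and the
    evaluation at \<open>i\<close> yields coordinate \<open>i\<close>.\<close>
  then have sum_E: "(\<Sum>x\<in>set_mset T. int (count T x) * f x)
      = int u * f (vec3 1 0 0) + int v * f (vec3 0 1 0) + int w * f (vec3 0 0 1)
        + int g * f (vec3 1 1 (int q - 1)) + int h * f (vec3 2 1 (int q - 1))" for f
  proof -
    have "(\<Sum>x\<in>set_mset T. int (count T x) * f x) = (\<Sum>x\<in>E. int (count T x) * f x)"
      using \<open>set_mset T \<subseteq> E\<close> by (intro sum.mono_neutral_left) (auto simp: E_def not_in_iff)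
    also have "\<dots> = int u * f (vec3 1 0 0) + int v * f (vec3 0 1 0) + int w * f (vec3 0 0 1)
        + int g * f (vec3 1 1 (int q - 1)) + int h * f (vec3 2 1 (int q - 1))"
      using assms(1) by (simp add: E_def vec3_eq_iff uvwgh)
    finally show ?thesis .
  qed
  have "int (size T) = (\<Sum>x\<in>set_mset T. int (count T x) * 1)"
    by (simp add: size_multiset_overloaded_eq)
  then have size: "size T = u + v + w + g + h"
    by (simp only: sum_E)
  have "sequence_over (cyclic_power q 3) T"
    using sequence_over_extremal_seq[OF assms(1)] set_mset_mono[OF assms(2)]
    by (auto simp: sequence_over_def)
  then have "int q dvd (\<Sum>x\<in>set_mset T. int (count T x) * x i)" if "i < 3" for i
    using zero_sum_cyclic_power_iff assms(1,4) that by auto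
  from this[of 0] this[of 1] this[of 2] have dvds:
    "int q dvd int u + int g + 2 * int h" "int q dvd int v + int g + int h"
    "int q dvd int w + (int q - 1) * int g + (int q - 1) * int h"
    by (simp_all only: sum_E) (simp_all add: mult.commute)
  have pos: "g + h > 0"
  proof (rule ccontr)
    assume "\<not> g + h > 0"
    then have "g = 0" "h = 0" by auto
    then have "q dvd u" "q dvd v" "q dvd w" using dvds by simp_all
    then have "u = 0" "v = 0" "w = 0"
      using bounds assms(1) by (auto dest!: dvd_imp_le)
    then show False using size \<open>g = 0\<close> \<open>h = 0\<close> assms(3) by simp
  qed
  show "2 * q - 1 \<le> size T"
    unfolding size using bounds assms(1) pos dvds by (intro zero_sum_coefficients) auto
  show "\<not> T \<subseteq># basis_seq q"
  proof
    assume "T \<subseteq># basis_seq q"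
    then have "count T x \<le> count (basis_seq q) x" for x by (rule mset_subset_eq_count)
    from this[of "vec3 1 1 (int q - 1)"] this[of "vec3 2 1 (int q - 1)"] show False
      using pos by (simp add: uvwgh basis_seq_def vec3_eq_iff)
  qed
qed

section \<open>The values of the two constants\<close>

lemma davenport_cyclic_power_3:
  fixes p :: nat
  assumes "prime p" "q = p ^ n" "q \<ge> 3"
  shows "davenport (cyclic_power q 3) = 3 * q - 2"
proof -
  let ?G = "cyclic_power q 3"
  have "(LEAST l. \<forall>S. sequence_over ?G S \<and> size S = l
      \<longrightarrow> (\<exists>T. T \<subseteq># S \<and> (T \<noteq> {#} \<and> zero_sum ?G T))) = Suc (3 * (q - 1))"
  proof (rule Least_forcing_length_eq)
    fix S assume S: "sequence_over ?G S" "size S = Suc (3 * (q - 1))"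
    \<comment> \<open>Nonemptiness is phrased through \<open>size T\<close>, the only datum besides
      zero-sum that the transfer from index sets carries.\<close>
    have "\<exists>T. T \<subseteq># S \<and> size T \<noteq> 0 \<and> zero_sum ?G T"
    proof (rule ex_zero_sum_submultiset[OF _ S(1)])
      fix a :: "nat \<Rightarrow> nat \<Rightarrow> nat"
      obtain T where "T \<subseteq> {..<size S}" "T \<noteq> {}" "\<forall>i\<in>{..<3}. q dvd sum (a i) T"
        using nonempty_zero_sum_subset[OF assms(1,2), of "{..<3::nat}" "{..<size S}" a] S(2) by auto
      then show "\<exists>T\<subseteq>{..<size S}. card T \<noteq> 0 \<and> (\<forall>i\<in>{..<3}. q dvd sum (a i) T)"
        by (metis card_0_eq finite_lessThan finite_subset)
    qed (use assms(3) in simp)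
    then show "\<exists>T. T \<subseteq># S \<and> (T \<noteq> {#} \<and> zero_sum ?G T)" by auto
  next
    have sub: "basis_seq q \<subseteq># extremal_seq q"
      by (simp add: extremal_seq_def add.assoc)
    then show "sequence_over ?G (basis_seq q)"
      using sequence_over_extremal_seq[OF assms(3)] set_mset_mono[OF sub]
      by (auto simp: sequence_over_def)
    show "size (basis_seq q) = 3 * (q - 1)" by (rule size_basis_seq)
    show "\<not> (T \<noteq> {#} \<and> zero_sum ?G T)" if "T \<subseteq># basis_seq q" for T
      using extremal_seq_zero_sum(2)[OF assms(3) subset_mset.order_trans[OF that sub]] that by blast
  qed
  then show ?thesis using assms(3) by (simp add: davenport_def)
qed

text \<open>Nonempty zero-sums in \<open>extremal_seq q\<close> have length at least
  \<open>2 * q - 1\<close>, just beyond the allowed \<open>2 * q - 2\<close>; one more term brings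
  \<open>short_zero_sum_subset\<close> into force.\<close>

lemma s_le_cyclic_power_3:
  fixes p :: nat
  assumes "prime p" "odd p" "q = p ^ n" "n > 0" "q \<ge> 3"
  shows "s_le (2 * q - 2) (cyclic_power q 3) = 4 * q - 2"
proof -
  let ?G = "cyclic_power q 3"
  have "(LEAST l. \<forall>S. sequence_over ?G S \<and> size S = l
      \<longrightarrow> (\<exists>T. T \<subseteq># S \<and> (1 \<le> size T \<and> size T \<le> 2 * q - 2 \<and> zero_sum ?G T)))
      = Suc (4 * (q - 1) + 1)"
  proof (rule Least_forcing_length_eq)
    fix S assume S: "sequence_over ?G S" "size S = Suc (4 * (q - 1) + 1)"
    have "\<exists>T. T \<subseteq># S \<and> (1 \<le> size T \<and> size T \<le> 2 * q - 2) \<and> zero_sum ?G T"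
    proof (rule ex_zero_sum_submultiset[OF _ S(1)])
      fix a :: "nat \<Rightarrow> nat \<Rightarrow> nat"
      have "card {..<size S} = 4 * q - 2" using S(2) assms(5) by simp
      then obtain T where "T \<subseteq> {..<size S}" "T \<noteq> {}" "card T \<le> 2 * q - 2"
          "\<forall>i\<in>{..<3}. q dvd sum (a i) T"
        using short_zero_sum_subset[OF assms(1-4), of "{..<3::nat}" "{..<size S}" a] by auto
      moreover from this have "card T \<noteq> 0"
        by (metis card_0_eq finite_lessThan finite_subset)
      ultimately show "\<exists>T\<subseteq>{..<size S}. (1 \<le> card T \<and> card T \<le> 2 * q - 2)
          \<and> (\<forall>i\<in>{..<3}. q dvd sum (a i) T)"
        by (intro exI[of _ T]) auto
    qed (use assms(5) in simp)
    then show "\<exists>T. T \<subseteq># S \<and> (1 \<le> size T \<and> size T \<le> 2 * q - 2 \<and> zero_sum ?G T)" by blast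
  next
    show "\<not> (1 \<le> size T \<and> size T \<le> 2 * q - 2 \<and> zero_sum ?G T)" if "T \<subseteq># extremal_seq q" for T
      using extremal_seq_zero_sum(1)[OF assms(5) that] assms(5) by fastforce
  qed (use assms in \<open>simp_all add: sequence_over_extremal_seq size_extremal_seq\<close>)
  then show ?thesis using assms(5) by (simp add: s_le_def)
qed

theorem theorem1p6:
  fixes p n :: nat and G :: "(nat \<Rightarrow> int) monoid"
  assumes "prime p" and "odd p" and "n > 0"
    and "G = cyclic_power (p ^ n) 3"
  shows "s_le (davenport G - p ^ n) G = davenport G + p ^ n"
proof -
  define q where "q = p ^ n"
  have "p \<ge> 3"
    using assms(1,2) prime_ge_2_nat[of p] by (cases "p = 2") auto
  then have q: "q \<ge> 3"
    using assms(3) self_le_power[of p n] by (simp add: q_def)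
  have "davenport G = 3 * q - 2"
    using davenport_cyclic_power_3[OF assms(1) q_def q] assms(4) by (simp add: q_def)
  moreover have "s_le (2 * q - 2) G = 4 * q - 2"
    using s_le_cyclic_power_3[OF assms(1,2) q_def assms(3) q] assms(4) by (simp add: q_def)
  moreover have "3 * q - 2 - q = 2 * q - 2" "3 * q - 2 + q = 4 * q - 2"
    using q by simp_all
  ultimately show ?thesis
    unfolding q_def[symmetric] by simp
qed

end
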